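(* Let $\mathbb{D}=\{z\in\mathbb{C}:|z|<1\}$, let $(a_n)_{n\in\mathbb{N}}$ be a sequence of points of $\mathbb{D}$ converging to a point of the boundary $\partial\mathbb{D}$, let $A=\{a_n:n\in\mathbb{N}\}$, and let $\Omega=\mathbb{D}\setminus A$ (an infinitely connected planar domain). Then for every $z\in\Omega$ the squeezing function of $\Omega$ at $z$ is $$S_{\Omega}(z)=\inf_{w\in A}\left|\frac{w-z}{1-\overline{z}w}\right|.$$
   Context: Squeezing function (in complex dimension one): let $\Omega\subseteq\mathbb{C}$ be a bounded domain and $z\in\Omega$. For a holomorphic embedding (injective holomorphic map) $f:\Omega\to\mathbb{D}$ with $f(z)=0$, put $$S_{\Omega}(z,f):=\sup\{r>0:\mathbb{D}(0,r)\subseteq f(\Omega)\},$$ where $\mathbb{D}(0,r)=\{\zeta\in\mathbb{C}:|\zeta|<r\}$. The squeezing function of $\Omega$ is $$S_{\Omega}(z):=\sup_f S_{\Omega}(z,f),$$ where the supremum is over all holomorphic embeddings $f:\Omega\to\mathbb{D}$ with $f(z)=0$. *)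

theory Defs
  imports "HOL-Complex_Analysis.Complex_Analysis"
begin

definition disc_embeddings :: "complex set \<Rightarrow> complex \<Rightarrow> (complex \<Rightarrow> complex) set" where
  "disc_embeddings \<Omega> z =
     {f. f holomorphic_on \<Omega> \<and> inj_on f \<Omega> \<and> f \<in> \<Omega> \<rightarrow> ball 0 1 \<and> f z = 0}"

text \<open>The quantity $S_\Omega(z,f)$; the base point $z$ enters only through the condition
  $f(z) = 0$ imposed on $f$.\<close>

definition squeezing_radius :: "complex set \<Rightarrow> (complex \<Rightarrow> complex) \<Rightarrow> real" where
  "squeezing_radius \<Omega> f = Sup {r. 0 < r \<and> ball 0 r \<subseteq> f ` \<Omega>}"

definition squeezing_function :: "complex set \<Rightarrow> complex \<Rightarrow> real" where
  "squeezing_function \<Omega> z = (SUP f\<in>disc_embeddings \<Omega> z. squeezing_radius \<Omega> f)"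

text \<open>Suprema of real sets carry their usual meaning only for nonempty sets that are bounded
  above; for a bounded domain both suprema above are of this kind.\<close>

lemma squeezing_radius_set_bdd_above:
  assumes "f \<in> disc_embeddings \<Omega> z"
  shows "bdd_above {r. 0 < r \<and> ball 0 r \<subseteq> f ` \<Omega>}"
proof (rule bdd_aboveI)
  fix r :: real
  assume r: "r \<in> {r. 0 < r \<and> ball 0 r \<subseteq> f ` \<Omega>}"
  have "f ` \<Omega> \<subseteq> ball 0 1"
    using assms by (auto simp: disc_embeddings_def)
  with r have "ball (0::complex) r \<subseteq> ball 0 1" by blast
  with r show "r \<le> 1" by (simp add: ball_subset_ball_iff)
qed

lemma squeezing_radius_set_nonempty:
  assumes "open \<Omega>" "connected \<Omega>" "z \<in> \<Omega>" "f \<in> disc_embeddings \<Omega> z"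
  shows "{r. 0 < r \<and> ball 0 r \<subseteq> f ` \<Omega>} \<noteq> {}"
proof -
  have "open (f ` \<Omega>)"
    using assms open_mapping_thm3[of f \<Omega>] by (auto simp: disc_embeddings_def)
  moreover have "0 \<in> f ` \<Omega>"
    using assms by (force simp: disc_embeddings_def)
  ultimately show ?thesis
    unfolding open_contains_ball by blast
qed

lemma disc_embeddings_nonempty:
  assumes "bounded \<Omega>"
  shows "disc_embeddings \<Omega> z \<noteq> {}"
proof -
  obtain R where R: "0 < R" "\<And>w. w \<in> \<Omega> \<Longrightarrow> dist z w < R"
    using bounded_subset_ballD[OF assms, of z] by (meson mem_ball subsetD)
  have "(\<lambda>w. (w - z) / of_real R) \<in> disc_embeddings \<Omega> z"
    using R by (auto simp: disc_embeddings_def inj_on_def norm_divide dist_norm norm_minus_commute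
        intro!: holomorphic_intros)
  then show ?thesis by blast
qed

lemma squeezing_radius_le_1:
  assumes "open \<Omega>" "connected \<Omega>" "z \<in> \<Omega>" "f \<in> disc_embeddings \<Omega> z"
  shows "squeezing_radius \<Omega> f \<le> 1"
  unfolding squeezing_radius_def
proof (rule cSup_least[OF squeezing_radius_set_nonempty[OF assms]])
  fix r :: real
  assume r: "r \<in> {r. 0 < r \<and> ball 0 r \<subseteq> f ` \<Omega>}"
  have "f ` \<Omega> \<subseteq> ball 0 1"
    using assms by (auto simp: disc_embeddings_def)
  with r have "ball (0::complex) r \<subseteq> ball 0 1" by blast
  with r show "r \<le> 1" by (simp add: ball_subset_ball_iff)
qed

lemma punctured_disc_domain:
  fixes a :: "nat \<Rightarrow> complex"
  assumes "range a \<subseteq> ball 0 1" and "a \<longlonglongrightarrow> p" and "norm p = 1"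
  shows "bounded (ball 0 1 - range a)" "open (ball 0 1 - range a)"
    "connected (ball 0 1 - range a)" "infinite (range a)"
proof -
  show "bounded (ball 0 1 - range a)"
    by (meson bounded_ball bounded_diff)
  have "closed (insert p (range a))"
    using compact_sequence_with_limit[OF assms(2)] compact_imp_closed by blast
  moreover have "ball 0 1 - range a = ball 0 1 - insert p (range a)"
    using assms(3) by auto
  ultimately show "open (ball 0 1 - range a)"
    by (metis open_Diff open_ball)
  show "connected (ball 0 1 - range a)"
    by (rule connected_open_diff_countable) auto
  show "infinite (range a)"
  proof
    assume "finite (range a)"
    then have "closed (range a)" by (rule finite_imp_closed)
    then have "p \<in> range a"
      using assms(2) closed_sequentially by blast
    with assms show False by auto
  qed
qed

end

theory Submission
  imports Defs
begin

text \<open>The Moebius map taking \<open>z\<close> to \<open>0\<close> is an embedding whose image misses exactly the images of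
  the points of \<open>A\<close>, so it realises the infimum. Conversely, an embedding \<open>f\<close> is bounded and \<open>A\<close>
  has no limit point in the disc, so \<open>f\<close> extends to an injective holomorphic self-map of the disc.
  A disc about \<open>0\<close> inside \<open>f ` \<Omega>\<close> omits the values of the extension on \<open>A\<close>, and the Schwarz-Pick
  lemma bounds the modulus of those values.\<close>

lemma not_islimpt_openE:
  fixes x :: "'a :: t2_space"
  assumes "\<not> x islimpt A" "open S" "x \<in> S"
  obtains U where "open U" "x \<in> U" "U \<subseteq> S" "U \<inter> A \<subseteq> {x}"
proof -
  obtain T where "open T" "x \<in> T" "\<And>y. y \<in> A \<Longrightarrow> y \<in> T \<Longrightarrow> y = x"
    using assms(1) unfolding islimpt_def by blast
  then show ?thesis
    using that[of "T \<inter> S"] assms by blast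
qed

text \<open>Inside \<open>S\<close> a point of the closure of \<open>A\<close> is not a limit point
  of \<open>A\<close>, hence is already in \<open>A\<close>; so removing \<open>A\<close> from
  \<open>S\<close> amounts to removing a closed set.\<close>

lemma open_Diff_no_limpt:
  assumes "open S" "\<And>x. x \<in> S \<Longrightarrow> \<not> x islimpt A"
  shows "open (S - A)"
proof -
  have "S - A = S - closure A"
    using assms(2) by (auto simp: closure_def)
  then show ?thesis
    using assms(1) by (simp add: open_Diff)
qed

text \<open>Riemann's removable singularity theorem, applied locally: each point of \<open>S\<close>
  has a neighbourhood that meets \<open>A\<close> at most in that point, and \<open>f\<close> is
  bounded there.\<close>

lemma
  assumes "open S" and lim: "\<And>x. x \<in> S \<Longrightarrow> \<not> x islimpt A"
    and holf: "f holomorphic_on S - A" and "bounded (f ` (S - A))"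
  shows remove_sings_holomorphic_on: "remove_sings f holomorphic_on S"
    and remove_sings_eq_off: "\<And>x. x \<in> S - A \<Longrightarrow> remove_sings f x = f x"
proof -
  have opn: "open (S - A)"
    by (rule open_Diff_no_limpt[OF assms(1) lim])
  show "remove_sings f x = f x" if "x \<in> S - A" for x
    using holf opn that by (intro remove_sings_at_analytic) (auto simp: analytic_at)
  have "remove_sings f analytic_on {x}" if x: "x \<in> S" for x
  proof -
    obtain U where U: "open U" "x \<in> U" "U \<subseteq> S" "U \<inter> A \<subseteq> {x}"
      using not_islimpt_openE[OF lim[OF x] assms(1) x] by blast
    have sub: "U - {x} \<subseteq> S - A"
      using U by blast
    have holU: "f holomorphic_on U - {x}"
      using holf sub by (rule holomorphic_on_subset)
    obtain B where B: "\<And>y. y \<in> S - A \<Longrightarrow> norm (f y) \<le> B"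
      using assms(4) unfolding bounded_iff by blast
    have "eventually (\<lambda>y. norm (f y) \<le> B) (at x)"
      unfolding eventually_at_topological using U sub B by (intro exI[of _ U]) blast
    moreover have "x \<in> interior U"
      using U by (simp add: interior_open)
    ultimately obtain g where g: "g holomorphic_on U" "\<And>y. y \<in> U - {x} \<Longrightarrow> g y = f y"
      using holomorphic_on_extend_bounded[OF holU] by blast
    \<comment> \<open>The local extension \<open>g\<close> supplies a finite limit of
      \<open>f\<close> at \<open>x\<close>, which is what makes the singularity removable.\<close>
    have "isolated_singularity_at f x"
      using U holU by (meson analytic_on_open isolated_singularity_at_iff_analytic_nhd
          open_delete)
    moreover have "g \<midarrow>x\<rightarrow> g x"
      using g U by (meson continuous_on_eq_continuous_at holomorphic_on_imp_continuous_on isContD)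
    then have "f \<midarrow>x\<rightarrow> g x"
      using Lim_transform_within_open[OF _ U(1,2)] g(2) by (metis DiffI singletonD)
    ultimately show ?thesis
      by (rule remove_sings_analytic_at)
  qed
  then show "remove_sings f holomorphic_on S"
    by (meson analytic_imp_holomorphic analytic_on_analytic_at)
qed

text \<open>If two points shared a value, disjoint neighbourhoods of them would have open images
  overlapping in further values, and these would be taken twice off \<open>A\<close>.\<close>

lemma inj_on_extend_no_limpt:
  fixes F :: "complex \<Rightarrow> complex"
  assumes "open S" and lim: "\<And>x. x \<in> S \<Longrightarrow> \<not> x islimpt A"
    and hol: "F holomorphic_on S" and inj: "inj_on F (S - A)"
  shows "inj_on F S"
proof (rule inj_onI, rule ccontr)
  fix x y assume xy: "x \<in> S" "y \<in> S" "F x = F y" "x \<noteq> y"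
  \<comment> \<open>\<open>S\<close> may be disconnected, so the open mapping theorem asks for
    nonconstancy on every nonempty open piece.\<close>
  have nonconst: "\<not> F constant_on X" if X: "open X" "X \<subseteq> S" "X \<noteq> {}" for X
  proof
    assume "F constant_on X"
    then have const: "F constant_on X - A"
      by (rule constant_on_subset) blast
    have opnX: "open (X - A)"
      using X lim by (intro open_Diff_no_limpt) auto
    have inX: "inj_on F (X - A)"
      using inj X by (meson Diff_mono inj_on_subset order_refl)
    obtain t where t: "t \<in> X" using X by blast
    obtain U where U: "open U" "t \<in> U" "U \<subseteq> X" "U \<inter> A \<subseteq> {t}"
      using not_islimpt_openE[OF lim] t X by (metis subsetD)
    have "t islimpt U"
      using U by (simp add: open_imp_islimpt)
    then have "X - A \<noteq> {}"
      using U unfolding islimpt_def by blast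
    then show False
      using injective_not_constant[OF opnX inX] const by blast
  qed
  have opn: "open (F ` U)" if "open U" "U \<subseteq> S" for U
    using open_mapping_thm2[OF hol \<open>open S\<close> that] nonconst by blast
  obtain V W where VW: "open V" "open W" "x \<in> V" "y \<in> W" "V \<inter> W = {}"
    using xy hausdorff by metis
  obtain V' where V': "open V'" "x \<in> V'" "V' \<subseteq> S \<inter> V" "V' \<inter> A \<subseteq> {x}"
    using not_islimpt_openE[OF lim[OF xy(1)], of "S \<inter> V"] VW xy \<open>open S\<close> by blast
  obtain W' where W': "open W'" "y \<in> W'" "W' \<subseteq> S \<inter> W" "W' \<inter> A \<subseteq> {y}"
    using not_islimpt_openE[OF lim[OF xy(2)], of "S \<inter> W"] VW xy \<open>open S\<close> by blast
  have "open (F ` V' \<inter> F ` W')"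
    using opn V' W' by (intro open_Int) auto
  moreover have "F x \<in> F ` V' \<inter> F ` W'"
    using V'(2) W'(2) xy(3) by (metis IntI imageI)
  \<comment> \<open>A common value \<open>v\<close> other than \<open>F x\<close> has preimages
    different from \<open>x\<close> and \<open>y\<close>, the only points of \<open>V'\<close> and
    \<open>W'\<close> that can lie in \<open>A\<close>.\<close>
  ultimately have "F x islimpt (F ` V' \<inter> F ` W')"
    by (simp add: open_imp_islimpt)
  then obtain v where v: "v \<in> F ` V'" "v \<in> F ` W'" "v \<noteq> F x"
    using islimptE[of "F x" _ UNIV] by blast
  then obtain s t where st: "s \<in> V'" "t \<in> W'" "v = F s" "v = F t"
    by blast
  then have "s \<noteq> x" "t \<noteq> y"
    using v(3) xy(3) by auto
  with st have "s \<in> S - A" "t \<in> S - A" "s \<noteq> t"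
    using V' W' VW by blast+
  then show False
    using inj st by (metis inj_onD)
qed

text \<open>\<open>Moebius_function 0 (- z)\<close> inverts \<open>Moebius_function 0 z\<close> and
  sends 0 to \<open>z\<close>, so composing \<open>F\<close> with it gives a self-map of the disc
  fixing 0, to which the Schwarz lemma applies.\<close>

lemma Schwarz_Pick_zero:
  assumes hol: "F holomorphic_on ball 0 1" and F: "F \<in> ball 0 1 \<rightarrow> ball 0 1" and "F z = 0"
    and z: "norm z < 1" and w: "norm w < 1"
  shows "norm (F w) \<le> norm (Moebius_function 0 z w)"
proof -
  let ?g = "F \<circ> Moebius_function 0 (- z)"
  have maps: "Moebius_function 0 (- z) \<in> ball 0 1 \<rightarrow> ball 0 1"
    using z Moebius_function_norm_lt_1 by simp
  have "?g holomorphic_on ball 0 1"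
    using z maps by (intro holomorphic_on_compose_gen[OF Moebius_function_holomorphic hol]) auto
  moreover have "?g 0 = 0"
    using \<open>F z = 0\<close> by (simp add: Moebius_function_of_zero)
  moreover have "norm (?g u) < 1" if "norm u < 1" for u
    using that maps F by (auto simp: Pi_iff)
  ultimately have "norm (?g (Moebius_function 0 z w)) \<le> norm (Moebius_function 0 z w)"
    using Schwarz_Lemma(1) Moebius_function_norm_lt_1 z w by blast
  then show ?thesis
    using Moebius_function_compose[of "- z" z w] z w by simp
qed

lemma Moebius_function_inj_on:
  assumes "norm z < 1"
  shows "inj_on (Moebius_function 0 z) (ball 0 1)"
  using Moebius_function_compose[of "- z" z] assms
  by (intro inj_on_inverseI[where g = "Moebius_function 0 (- z)"]) auto

text \<open>Each point of \<open>A\<close> yields one bound on \<open>r\<close>; together they bound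
  \<open>r\<close> by the infimum in the theorem.\<close>

lemma disc_embedding_omitted_bound:
  assumes lim: "\<And>x. x \<in> ball 0 1 \<Longrightarrow> \<not> x islimpt A" and "A \<subseteq> ball 0 1"
    and z: "z \<in> ball 0 1 - A" and f: "f \<in> disc_embeddings (ball 0 1 - A) z"
    and sub: "ball 0 r \<subseteq> f ` (ball 0 1 - A)" and w: "w \<in> A"
  shows "r \<le> norm (Moebius_function 0 z w)"
proof -
  define F where "F = remove_sings f"
  have f: "f holomorphic_on ball 0 1 - A" "inj_on f (ball 0 1 - A)"
    "f ` (ball 0 1 - A) \<subseteq> ball 0 1" "f z = 0"
    using f by (auto simp: disc_embeddings_def)
  have bdd: "bounded (f ` (ball 0 1 - A))"
    using f(3) bounded_ball bounded_subset by blast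
  have hol: "F holomorphic_on ball 0 1"
    unfolding F_def by (rule remove_sings_holomorphic_on[OF open_ball lim f(1) bdd])
  have eq: "F x = f x" if "x \<in> ball 0 1 - A" for x
    unfolding F_def by (rule remove_sings_eq_off[OF open_ball lim f(1) bdd that])
  have "inj_on F (ball 0 1 - A)"
    using f(2) eq inj_on_cong by blast
  then have inj: "inj_on F (ball 0 1)"
    using inj_on_extend_no_limpt[OF open_ball lim hol] by blast
  \<comment> \<open>At points of \<open>A\<close> the value of \<open>F\<close> is only a limit of
    values of \<open>f\<close>, so at first it is known to lie in the closed disc.\<close>
  have "F x \<in> cball 0 1" if x: "x \<in> ball 0 1" for x
  proof (rule Lim_in_closed_set)
    obtain U where U: "open U" "x \<in> U" "U \<subseteq> ball 0 1" "U \<inter> A \<subseteq> {x}"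
      using not_islimpt_openE[OF lim[OF x] open_ball x] by blast
    have "F y \<in> cball 0 1" if "y \<in> U" "y \<noteq> x" for y
    proof -
      have "y \<in> ball 0 1 - A"
        using that U by blast
      then show ?thesis
        using eq f(3) by fastforce
    qed
    then show "\<forall>\<^sub>F y in at x. F y \<in> cball 0 1"
      unfolding eventually_at_topological using U by blast
    show "F \<midarrow>x\<rightarrow> F x"
      using hol x by (meson continuous_on_eq_continuous_at holomorphic_on_imp_continuous_on isContD
          open_ball)
  qed auto
  then have "F ` ball 0 1 \<subseteq> cball 0 1"
    by blast
  \<comment> \<open>The image is open because \<open>F\<close> is injective and holomorphic, so it
    avoids the unit circle.\<close>
  then have "F ` ball 0 1 \<subseteq> interior (cball 0 1)"
    by (rule interior_maximal) (rule open_mapping_thm3[OF hol open_ball inj])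
  then have "F \<in> ball 0 1 \<rightarrow> ball 0 1"
    by auto
  then have "norm (F w) \<le> norm (Moebius_function 0 z w)"
    using Schwarz_Pick_zero[OF hol] eq[OF z] f(4) z w \<open>A \<subseteq> ball 0 1\<close> by auto
  moreover have "F w \<notin> f ` (ball 0 1 - A)"
  proof
    assume "F w \<in> f ` (ball 0 1 - A)"
    then obtain x where "x \<in> ball 0 1 - A" "F w = F x"
      using eq by auto
    then show False
      using inj w \<open>A \<subseteq> ball 0 1\<close> by (metis DiffE inj_onD subsetD)
  qed
  then have "F w \<notin> ball 0 r"
    using sub by blast
  ultimately show ?thesis
    by simp
qed

theorem theorem1p1:
  fixes a :: "nat \<Rightarrow> complex" and p z :: complex and A \<Omega> :: "complex set"
  assumes "\<And>n. a n \<in> ball 0 1"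
    and "a \<longlonglongrightarrow> p" and "p \<in> frontier (ball 0 1)"
    and "A = range a"
    and "\<Omega> = ball 0 1 - A"
    and "z \<in> \<Omega>"
  shows "squeezing_function \<Omega> z = (INF w\<in>A. cmod ((w - z) / (1 - cnj z * w)))"
proof -
  let ?M = "Moebius_function 0 z"
  define m where "m = (INF w\<in>A. norm (?M w))"
  have p: "norm p = 1"
    using assms(3) by (simp add: frontier_ball)
  have sub: "A \<subseteq> ball 0 1"
    using assms by auto
  have "A \<noteq> {}"
    using assms(4) by auto
  \<comment> \<open>The range of a convergent sequence has no limit point other than its limit, here
    \<open>p\<close> on the unit circle.\<close>
  have lim: "\<not> x islimpt A" if "x \<in> ball 0 1" for x
    using sequence_unique_limpt[OF assms(2)] that p assms(4) by auto
  have z: "z \<in> ball 0 1 - A" "norm z < 1"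
    using assms by auto
  have dom: "open \<Omega>" "connected \<Omega>"
    using punctured_disc_domain(2,3)[OF _ assms(2) p] sub assms(4,5) by auto
  have bdd: "bdd_below ((\<lambda>w. norm (?M w)) ` A)"
    by (auto intro: bdd_belowI[of _ 0])
  have upper: "r \<le> m" if "f \<in> disc_embeddings \<Omega> z" "ball 0 r \<subseteq> f ` \<Omega>" for f r
    unfolding m_def using that disc_embedding_omitted_bound[OF lim sub z(1)] \<open>A \<noteq> {}\<close> assms(5)
    by (intro cINF_greatest) auto
  have radius_le: "squeezing_radius \<Omega> f \<le> m" if "f \<in> disc_embeddings \<Omega> z" for f
    unfolding squeezing_radius_def
    using squeezing_radius_set_nonempty[OF dom assms(6) that] upper[OF that]
    by (intro cSup_least) auto
  have M: "?M \<in> disc_embeddings \<Omega> z"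
    unfolding disc_embeddings_def
    using z assms(5) Moebius_function_holomorphic[of z 0] Moebius_function_inj_on[of z]
      Moebius_function_norm_lt_1[of z _ 0]
    by (auto simp: Moebius_function_eq_zero intro: holomorphic_on_subset inj_on_subset)
  have img: "ball 0 m \<subseteq> ?M ` \<Omega>"
  proof
    fix v :: complex assume v: "v \<in> ball 0 m"
    \<comment> \<open>A single point of \<open>A\<close> shows \<open>m < 1\<close>, so
      \<open>v\<close> is in the unit disc and the inverse Moebius map can be applied to it.\<close>
    obtain w where "w \<in> A" using \<open>A \<noteq> {}\<close> by blast
    then have "m \<le> norm (?M w)" "norm (?M w) < 1"
      unfolding m_def using cINF_lower[OF bdd] Moebius_function_norm_lt_1[of z w 0] sub z by auto
    then have v1: "norm v < 1"
      using v by simp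
    let ?u = "Moebius_function 0 (- z) v"
    have u: "?M ?u = v" "?u \<in> ball 0 1"
      using Moebius_function_compose[of z "- z" v] Moebius_function_norm_lt_1[of "- z" v 0] z v1
      by auto
    moreover have "?u \<notin> A"
    proof
      assume "?u \<in> A"
      then have "m \<le> norm v"
        unfolding m_def using cINF_lower[OF bdd] u(1) by metis
      then show False
        using v by simp
    qed
    ultimately show "v \<in> ?M ` \<Omega>"
      using assms(5) by (intro image_eqI[of _ _ ?u]) auto
  qed
  \<comment> \<open>The supremum in \<open>squeezing_radius\<close> runs over positive radii only,
    so \<open>m\<close> must be positive to be one of them. The open image of \<open>?M\<close>
    contains some disc about 0, and its radius is at most \<open>m\<close>.\<close>
  have "0 < m"
  proof -
    obtain r where "0 < r" "ball 0 r \<subseteq> ?M ` \<Omega>"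
      using squeezing_radius_set_nonempty[OF dom assms(6) M] by auto
    then show ?thesis
      using upper[OF M] by fastforce
  qed
  then have "m \<le> squeezing_radius \<Omega> ?M"
    unfolding squeezing_radius_def
    using img squeezing_radius_set_bdd_above[OF M] by (intro cSup_upper) auto
  then have "squeezing_radius \<Omega> ?M = m"
    using radius_le[OF M] by simp
  \<comment> \<open>The supremum over all embeddings is a maximum, attained at
    \<open>?M\<close>.\<close>
  then have "squeezing_function \<Omega> z = m"
    unfolding squeezing_function_def
    using M radius_le by (intro cSup_eq_maximum) (auto intro: image_eqI[OF sym])
  then show ?thesis
    by (simp add: m_def Moebius_function_simple)
qed

end
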